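(* Let $Z_0\in(0,1)$ be non-random, $L_0=R_0=1$, and let $\{\xi_n,U_n\}_{n=1}^\infty$ be i.i.d. random variables uniformly distributed on $[0,1]$. For $n=1,2,\dots$ define $$Z_n=Z_{n-1}\xi_n\mathbf{1}_{\left\{U_n<\frac{L_{n-1}}{L_{n-1}+R_{n-1}}\right\}}+\left[Z_{n-1}+(1-Z_{n-1})\xi_n\right]\mathbf{1}_{\left\{U_n\ge\frac{L_{n-1}}{L_{n-1}+R_{n-1}}\right\}},$$ $$L_n=L_{n-1}+Z_{n-1}\mathbf{1}_{\left\{U_n<\frac{L_{n-1}}{L_{n-1}+R_{n-1}}\right\}},\qquad R_n=R_{n-1}+(1-Z_{n-1})\mathbf{1}_{\left\{U_n\ge\frac{L_{n-1}}{L_{n-1}+R_{n-1}}\right\}}.$$ Then, as $n\to\infty$, $Z_n$ converges in distribution to a $\mathrm{Beta}\left(\frac12,\frac12\right)$ random variable.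
   Context: $\mathrm{Beta}(a,b)$ denotes the distribution on $(0,1)$ with density $\frac{\Gamma(a+b)}{\Gamma(a)\Gamma(b)}x^{a-1}(1-x)^{b-1}$; $\mathrm{Beta}(\frac12,\frac12)$ is the arcsine law. All the variables $\xi_1,U_1,\xi_2,U_2,\dots$ are mutually independent. *)

theory Defs
  imports "HOL-Probability.Probability"
begin

definition beta_density :: "real \<Rightarrow> real \<Rightarrow> real \<Rightarrow> real" where
  "beta_density a b x =
     (if 0 < x \<and> x < 1
      then Gamma (a + b) / (Gamma a * Gamma b) * x powr (a - 1) * (1 - x) powr (b - 1)
      else 0)"

definition beta_distribution :: "real \<Rightarrow> real \<Rightarrow> real measure" where
  "beta_distribution a b = density lborel (\<lambda>x. ennreal (beta_density a b x))"

end

theory Submission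
  imports Defs "HOL-Real_Asymp.Real_Asymp"
begin

text \<open>
  The proof rests on the fact that \<open>left_prob = L / (L + R)\<close>, the conditional probability of a move to
  the left, tends to \<open>1/2\<close> in the mean. Once this is known, the walk is an asymptotically
  small perturbation of the chain that moves left or right with probability \<open>1/2\<close> each, and that chain
  has the arcsine law as its stationary law.

  \<^bold>\<open>The left probability tends to one half.\<close> Its distance to \<open>1/2\<close> is \<open>\<bar>L - R\<bar> / (2 (L + R))\<close>, so
  numerator and denominator are to be compared. The numerator is small because \<open>L - R + 2 Z\<close> is a
  martingale with increments bounded by \<open>1\<close>: a move to the left changes it by \<open>Z (2 \<xi> - 1)\<close>, a move to
  the right by \<open>(1 - Z) (2 \<xi> - 1)\<close>, and both have mean zero. Hence \<open>L - R\<close> is of order \<open>sqrt n\<close> in mean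
  square (\<open>second_moment_balance\<close>). The denominator is large because \<open>1 / (L R)\<close> is a supermartingale
  whose conditional expectation shrinks at each step by a factor of at most \<open>1 - 1 / (2 (L + R))\<close>
  (\<open>inverse_product_drift\<close>). As \<open>L + R\<close> never decreases, staying below a level \<open>x\<close> up to time \<open>n\<close> forces
  \<open>n\<close> contractions by \<open>1 - 1 / (2 x)\<close>, whereas \<open>1 / (L R) \<ge> 4 / x\<^sup>2\<close> there
  (\<open>expected_inverse_product_le\<close>). So \<open>L + R \<le> n powr (3/4)\<close> has probability at most
  of order \<open>n powr (3/2) * exp (- n powr (1/4) / 2)\<close>, and \<open>sqrt n\<close> is negligible against \<open>n powr (3/4)\<close>
  (\<open>left_prob_tendsto_half\<close>).

  \<^bold>\<open>Moments.\<close> Integrating out \<open>\<xi>\<close> and \<open>U\<close> in one step, the \<open>k\<close>-th moment of the next position is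
  \<open>1 / (k + 1)\<close> times that of the present one, plus a combination of lower moments in which the right
  probability enters only as a bounded factor (\<open>moment_step\<close>). Replacing that factor by \<open>1/2\<close> costs an
  error tending to \<open>0\<close>, so induction on \<open>k\<close> and a contraction argument for perturbed linear recursions
  show that the moments converge to numbers \<open>\<mu> k\<close> with \<open>\<mu> 0 + ... + \<mu> (k - 1) = 2 k \<mu> k\<close>. The recursion
  of the Beta function gives the same identity for the arcsine moments (\<open>sum_arcsine_moments\<close>). On the
  unit interval, convergence of moments implies weak convergence by Weierstrass approximation
  (\<open>weak_conv_if_moments_converge\<close>).
\<close>

section \<open>Moment convergence on the unit interval\<close>

text \<open>
  The distance to the fixed point \<open>\<beta> / (1 - r)\<close> of the limiting recursion is contracted by \<open>r\<close> at each
  step, up to an error that eventually stays below any given bound.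
\<close>

lemma linear_recursion_tendsto:
  fixes a b :: "nat \<Rightarrow> real"
  assumes rec: "\<And>n. a (Suc n) = r * a n + b n" and r: "0 \<le> r" "r < 1" and b: "b \<longlonglongrightarrow> \<beta>"
  shows "a \<longlonglongrightarrow> \<beta> / (1 - r)"
proof -
  define l where "l = \<beta> / (1 - r)"
  have fixpoint: "l = r * l + \<beta>" using r by (simp add: l_def field_simps)
  have "a \<longlonglongrightarrow> l"
  proof (rule LIMSEQ_I)
    fix e :: real assume "0 < e"
    (* chosen so that \<open>e / 2\<close> solves \<open>t = r t + \<delta>\<close> *)
    define \<delta> where "\<delta> = e / 2 * (1 - r)"
    have "\<delta> > 0" using \<open>0 < e\<close> r by (simp add: \<delta>_def)
    from LIMSEQ_D[OF b this] obtain N where N: "\<And>n. n \<ge> N \<Longrightarrow> \<bar>b n - \<beta>\<bar> < \<delta>" by auto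
    have bound: "\<bar>a (N + j) - l\<bar> \<le> r ^ j * \<bar>a N - l\<bar> + e / 2" for j
    proof (induction j)
      case (Suc j)
      have "a (N + Suc j) - l = r * (a (N + j) - l) + (b (N + j) - \<beta>)"
        using rec[of "N + j"] fixpoint by (simp add: algebra_simps)
      then have "\<bar>a (N + Suc j) - l\<bar> \<le> r * \<bar>a (N + j) - l\<bar> + \<bar>b (N + j) - \<beta>\<bar>"
        using abs_triangle_ineq[of "r * (a (N + j) - l)" "b (N + j) - \<beta>"] r by (simp add: abs_mult)
      also have "\<dots> \<le> r * (r ^ j * \<bar>a N - l\<bar> + e / 2) + \<delta>"
        using Suc N[of "N + j"] r by (intro add_mono mult_left_mono) auto
      also have "\<dots> = r ^ Suc j * \<bar>a N - l\<bar> + e / 2" by (simp add: \<delta>_def field_simps)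
      finally show ?case .
    qed (use \<open>0 < e\<close> in simp)
    have "(\<lambda>j. r ^ j * \<bar>a N - l\<bar>) \<longlonglongrightarrow> 0"
      using r by (intro tendsto_mult_left_zero LIMSEQ_power_zero) auto
    from LIMSEQ_D[OF this, of "e / 2"] \<open>0 < e\<close> obtain J
      where J: "\<And>j. j \<ge> J \<Longrightarrow> r ^ j * \<bar>a N - l\<bar> < e / 2" using r by auto
    have "norm (a n - l) < e" if "n \<ge> N + J" for n
      using bound[of "n - N"] J[of "n - N"] that unfolding real_norm_def by fastforce
    then show "\<exists>no. \<forall>n\<ge>no. norm (a n - l) < e" by blast
  qed
  then show ?thesis by (simp add: l_def)
qed

text \<open>
  Convergence of moments is convergence of the integrals of polynomials, and on \<open>{0..1}\<close> polynomials
  approximate uniformly the continuous step functions that determine weak convergence.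
\<close>

lemma weak_conv_if_moments_converge:
  fixes \<mu> :: "nat \<Rightarrow> real measure" and \<nu> :: "real measure"
  assumes \<mu>: "\<And>n. real_distribution (\<mu> n)" and \<nu>: "real_distribution \<nu>"
    and supp: "\<And>n. AE x in \<mu> n. x \<in> {0..1}" "AE x in \<nu>. x \<in> {0..1}"
    and mom: "\<And>k. (\<lambda>n. \<integral>x. x ^ k \<partial>\<mu> n) \<longlonglongrightarrow> (\<integral>x. x ^ k \<partial>\<nu>)"
  shows "weak_conv_m \<mu> \<nu>"
proof (rule integral_cts_step_conv_imp_weak_conv[OF \<mu> \<nu>])
  fix x y :: real assume "x < y"
  define f where "f = cts_step x y"
  have cont: "continuous_on UNIV f"
    unfolding f_def using cts_step_uniformly_continuous[OF \<open>x < y\<close>]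
    by (rule uniformly_continuous_imp_continuous)
  have int_f: "integrable m f" if "real_distribution m" for m
    unfolding f_def using real_distribution.integrable_cts_step[OF that \<open>x < y\<close>] .
  have int_pow: "integrable m (\<lambda>x. x ^ k)"
    if m: "real_distribution m" "AE x in m. x \<in> {0..1}" for m and k :: nat
  proof -
    interpret real_distribution m by (rule m)
    show ?thesis
    proof (rule integrable_const_bound[of _ 1])
      show "AE x in m. norm (x ^ k) \<le> 1"
        using m(2) by eventually_elim (auto intro!: power_le_one)
    qed simp
  qed
  show "(\<lambda>n. integral\<^sup>L (\<mu> n) f) \<longlonglongrightarrow> integral\<^sup>L \<nu> f"
  proof (rule LIMSEQ_I)
    fix e :: real assume "0 < e"
    then obtain g where g: "real_polynomial_function g" "\<And>x. x \<in> {0..1} \<Longrightarrow> \<bar>f x - g x\<bar> < e / 3"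
      using Stone_Weierstrass_real_polynomial_function[of "{0..1}" f "e / 3"]
        continuous_on_subset[OF cont] by auto
    obtain c d where c: "g = (\<lambda>x. \<Sum>i\<le>d. c i * x ^ i)"
      using g(1) by (auto simp: real_polynomial_function_iff_sum)
    have int_g: "integrable m g" and eq_g: "integral\<^sup>L m g = (\<Sum>i\<le>d. c i * (\<integral>x. x ^ i \<partial>m))"
      if m: "real_distribution m" "AE x in m. x \<in> {0..1}" for m
      unfolding c using int_pow[OF m] by auto
    have approx: "\<bar>integral\<^sup>L m f - integral\<^sup>L m g\<bar> \<le> e / 3"
      if m: "real_distribution m" "AE x in m. x \<in> {0..1}" for m
    proof -
      interpret real_distribution m by (rule m)
      have "\<bar>integral\<^sup>L m f - integral\<^sup>L m g\<bar> = \<bar>\<integral>x. f x - g x \<partial>m\<bar>"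
        using int_f[OF m(1)] int_g[OF m] by simp
      also have "\<dots> \<le> (\<integral>x. \<bar>f x - g x\<bar> \<partial>m)" by (rule integral_abs_bound)
      also have "\<dots> \<le> (\<integral>x. e / 3 \<partial>m)"
      proof (rule integral_mono_AE)
        show "AE x in m. \<bar>f x - g x\<bar> \<le> e / 3"
          using m(2) by eventually_elim (use g(2) in \<open>auto intro: less_imp_le\<close>)
      qed (use int_f[OF m(1)] int_g[OF m] in auto)
      finally show ?thesis by (simp add: prob_space del: space_eq_univ)
    qed
    have "(\<lambda>n. integral\<^sup>L (\<mu> n) g) \<longlonglongrightarrow> integral\<^sup>L \<nu> g"
      unfolding eq_g[OF \<mu> supp(1)] eq_g[OF \<nu> supp(2)] by (intro tendsto_intros mom)
    from LIMSEQ_D[OF this, of "e / 3"] \<open>0 < e\<close> obtain N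
      where N: "\<And>n. n \<ge> N \<Longrightarrow> \<bar>integral\<^sup>L (\<mu> n) g - integral\<^sup>L \<nu> g\<bar> < e / 3" by auto
    have "norm (integral\<^sup>L (\<mu> n) f - integral\<^sup>L \<nu> f) < e" if "n \<ge> N" for n
      using N[OF that] approx[OF \<mu> supp(1), of n] approx[OF \<nu> supp(2)]
      unfolding real_norm_def by linarith
    then show "\<exists>no. \<forall>n\<ge>no. norm (integral\<^sup>L (\<mu> n) f - integral\<^sup>L \<nu> f) < e" by blast
  qed
qed

section \<open>Moments of the Beta distribution\<close>

lemma borel_measurable_beta_density [measurable]: "beta_density a b \<in> borel_measurable borel"
  unfolding beta_density_def by measurable

lemma beta_density_nonneg: "0 < a \<Longrightarrow> 0 < b \<Longrightarrow> 0 \<le> beta_density a b x"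
  by (auto simp: beta_density_def intro!: mult_nonneg_nonneg divide_nonneg_pos less_imp_le[OF Gamma_real_pos])

lemma power_times_beta_density_nonneg:
  assumes "0 < a" "0 < b" shows "0 \<le> x ^ k * beta_density a b x"
proof (cases "0 < x")
  case True then show ?thesis using beta_density_nonneg[OF assms] by simp
qed (simp add: beta_density_def)

lemma nn_integral_beta_moment:
  assumes "0 < a" "0 < b"
  shows "(\<integral>\<^sup>+x. ennreal (x ^ k * beta_density a b x) \<partial>lborel) = ennreal (Beta (a + real k) b / Beta a b)"
proof (rule nn_integral_has_integral_lborel)
  show "0 \<le> x ^ k * beta_density a b x" for x
    using assms by (rule power_times_beta_density_nonneg)
  have "((\<lambda>t. (t powr (a + real k - 1) * (1 - t) powr (b - 1)) / Beta a b)
           has_integral Beta (a + real k) b / Beta a b) {0..1}"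
    using assms by (intro has_integral_divide has_integral_Beta_real) auto
  also have "?this \<longleftrightarrow> ((\<lambda>x. x ^ k * beta_density a b x) has_integral Beta (a + real k) b / Beta a b) {0..1}"
  proof (rule has_integral_cong)
    fix x :: real assume "x \<in> {0..1}"
    then consider "x = 0" | "x = 1" | "0 < x" "x < 1" by fastforce
    then show "x powr (a + real k - 1) * (1 - x) powr (b - 1) / Beta a b = x ^ k * beta_density a b x"
    proof cases
      case 3
      have "x powr (a + real k - 1) = x powr (real k + (a - 1))" by (simp add: algebra_simps)
      also have "\<dots> = x ^ k * x powr (a - 1)" using 3 by (simp only: powr_add powr_realpow)
      finally show ?thesis using 3 by (simp add: beta_density_def Beta_def)
    qed (auto simp: beta_density_def)
  qed
  finally show "((\<lambda>x. x ^ k * beta_density a b x) has_integral Beta (a + real k) b / Beta a b) UNIV"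
    by (rule has_integral_on_superset) (auto simp: beta_density_def)
qed simp

lemma Beta_real_pos: "0 < a \<Longrightarrow> 0 < b \<Longrightarrow> 0 < (Beta a b :: real)"
  by (simp add: Beta_def)

lemma real_distribution_beta:
  assumes "0 < a" "0 < b"
  shows "real_distribution (beta_distribution a b)"
proof -
  have "emeasure (beta_distribution a b) (space (beta_distribution a b)) = 1"
    using nn_integral_beta_moment[OF assms, of 0] Beta_real_pos[OF assms]
    by (simp add: beta_distribution_def emeasure_density)
  then show ?thesis
    by (intro real_distribution.intro prob_spaceI real_distribution_axioms.intro)
       (simp_all add: beta_distribution_def)
qed

lemma AE_beta_distribution: "AE x in beta_distribution a b. x \<in> {0..1}"
  unfolding beta_distribution_def by (subst AE_density) (auto simp: beta_density_def)

lemma beta_moment: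
  assumes "0 < a" "0 < b"
  shows "(\<integral>x. x ^ k \<partial>beta_distribution a b) = Beta (a + real k) b / Beta a b"
proof -
  have "(\<integral>x. x ^ k \<partial>beta_distribution a b) = (\<integral>x. x ^ k * beta_density a b x \<partial>lborel)"
    unfolding beta_distribution_def
    by (subst integral_density) (auto simp: beta_density_nonneg assms mult.commute)
  also have "\<dots> = Beta (a + real k) b / Beta a b"
  proof (subst integral_eq_nn_integral)
    show "AE x in lborel. 0 \<le> x ^ k * beta_density a b x"
      using power_times_beta_density_nonneg[OF assms] by simp
  qed (use assms Beta_real_pos[of a b] Beta_real_pos[of "a + real k" b] in \<open>simp_all add: nn_integral_beta_moment\<close>)
  finally show ?thesis .
qed

text \<open>
  The ratio of consecutive arcsine moments is \<open>(k + 1/2) / (k + 1)\<close>, by the functional equation of the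
  Beta function; this makes the sum telescope. The identity is the stationarity condition, on the
  level of moments, for the walk that moves left and right with equal probability.
\<close>

lemma sum_arcsine_moments:
  defines "m \<equiv> \<lambda>k. Beta (1 / 2 + real k) (1 / 2) / Beta (1 / 2) (1 / 2 :: real)"
  shows "(\<Sum>j<k. m j) = 2 * real k * m k"
proof (induction k)
  case (Suc k)
  have "1 / 2 + real k \<notin> \<int>\<^sub>\<le>\<^sub>0" by (auto elim!: nonpos_Ints_cases' )
  from Beta_plus1_left[OF this, of "1 / 2"]
  have "(real k + 1) * m (Suc k) = (1 / 2 + real k) * m k"
    by (simp add: m_def algebra_simps)
  with Suc show ?case by (simp add: algebra_simps)
qed simp

section \<open>Averaging over uniform noise\<close>

text \<open>
  Averaging out one step of a Markov chain that branches to the left when \<open>V < p\<close>. Independence of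
  the state and the noise enters as a product form of the joint law, to which Fubini's theorem applies:
  averaging over \<open>V\<close> produces the weights \<open>p\<close> and \<open>1 - p\<close>, averaging over \<open>\<xi>\<close> the inner integrals.
\<close>

lemma (in prob_space) expectation_uniform_branch:
  fixes X :: "'a \<Rightarrow> 'b" and \<xi> V :: "'a \<Rightarrow> real" and p :: "'b \<Rightarrow> real" and A B :: "'b \<Rightarrow> real \<Rightarrow> real"
  defines "unif \<equiv> uniform_measure lborel {0..1 :: real}"
  assumes [measurable]: "X \<in> measurable M N" "\<xi> \<in> borel_measurable M" "V \<in> borel_measurable M"
    and joint: "distr M (N \<Otimes>\<^sub>M (borel \<Otimes>\<^sub>M borel)) (\<lambda>\<omega>. (X \<omega>, \<xi> \<omega>, V \<omega>)) =
      distr M N X \<Otimes>\<^sub>M (unif \<Otimes>\<^sub>M unif)"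
    and unif: "distr M borel \<xi> = unif"
    and [measurable]: "p \<in> borel_measurable N"
      "case_prod A \<in> borel_measurable (N \<Otimes>\<^sub>M borel)" "case_prod B \<in> borel_measurable (N \<Otimes>\<^sub>M borel)"
    and bnd: "AE \<omega> in M. p (X \<omega>) \<in> {0..1} \<and> (\<forall>s\<in>{0..1}. \<bar>A (X \<omega>) s\<bar> \<le> C \<and> \<bar>B (X \<omega>) s\<bar> \<le> C)"
  shows "expectation (\<lambda>\<omega>. if V \<omega> < p (X \<omega>) then A (X \<omega>) (\<xi> \<omega>) else B (X \<omega>) (\<xi> \<omega>)) =
    expectation (\<lambda>\<omega>. p (X \<omega>) * (\<integral>s. A (X \<omega>) s \<partial>unif) + (1 - p (X \<omega>)) * (\<integral>s. B (X \<omega>) s \<partial>unif))"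
proof -
  define F where "F = (\<lambda>(x, s, u). if u < p x then A x s else B x s)"
  have [measurable]: "F \<in> borel_measurable (N \<Otimes>\<^sub>M (borel \<Otimes>\<^sub>M borel))"
    unfolding F_def by measurable
  interpret unif: prob_space unif
    unfolding unif_def by (rule prob_space_uniform_measure) auto
  have [measurable_cong]: "sets unif = sets borel" by (simp add: unif_def)
  have AE_unif: "AE s in unif. s \<in> {0..1}"
    unfolding unif_def by (rule AE_uniform_measureI) auto
  interpret U2: pair_prob_space unif unif ..
  interpret DX: prob_space "distr M N X" by (rule prob_space_distr) simp
  interpret D: pair_prob_space "distr M N X" "unif \<Otimes>\<^sub>M unif" ..
  have AE_\<xi>: "AE \<omega> in M. \<xi> \<omega> \<in> {0..1}"
    using AE_unif unfolding unif[symmetric] by (subst (asm) AE_distr_iff) auto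
  have "integrable M (\<lambda>\<omega>. F (X \<omega>, \<xi> \<omega>, V \<omega>))"
    using bnd AE_\<xi> by (intro integrable_const_bound[of _ C]) (auto simp: F_def elim!: AE_mp)
  then have intF: "integrable (distr M N X \<Otimes>\<^sub>M (unif \<Otimes>\<^sub>M unif)) F"
    unfolding joint[symmetric] by (subst integrable_distr_eq) auto
  have "expectation (\<lambda>\<omega>. F (X \<omega>, \<xi> \<omega>, V \<omega>)) = integral\<^sup>L (distr M N X \<Otimes>\<^sub>M (unif \<Otimes>\<^sub>M unif)) F"
    unfolding joint[symmetric] by (subst integral_distr) auto
  also have "\<dots> = (\<integral>x. (\<integral>y. F (x, y) \<partial>(unif \<Otimes>\<^sub>M unif)) \<partial>distr M N X)"
    by (rule D.integral_fst'[OF intF, symmetric])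
  also have "\<dots> = expectation (\<lambda>\<omega>. \<integral>y. F (X \<omega>, y) \<partial>(unif \<Otimes>\<^sub>M unif))"
    by (rule integral_distr) auto
  also have "\<dots> = expectation (\<lambda>\<omega>. p (X \<omega>) * (\<integral>s. A (X \<omega>) s \<partial>unif) + (1 - p (X \<omega>)) * (\<integral>s. B (X \<omega>) s \<partial>unif))"
  proof (rule integral_cong_AE)
    show "AE \<omega> in M. (\<integral>y. F (X \<omega>, y) \<partial>(unif \<Otimes>\<^sub>M unif)) =
        p (X \<omega>) * (\<integral>s. A (X \<omega>) s \<partial>unif) + (1 - p (X \<omega>)) * (\<integral>s. B (X \<omega>) s \<partial>unif)"
      using bnd AE_space
    proof eventually_elim
      case (elim \<omega>)
      define x where "x = X \<omega>"
      have x: "p x \<in> {0..1}" "\<And>s. s \<in> {0..1} \<Longrightarrow> \<bar>A x s\<bar> \<le> C" "\<And>s. s \<in> {0..1} \<Longrightarrow> \<bar>B x s\<bar> \<le> C"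
        using elim by (auto simp: x_def)
      have "x \<in> space N" using elim measurable_space[of X M N] by (auto simp: x_def)
      then have [measurable]: "A x \<in> borel_measurable borel" "B x \<in> borel_measurable borel"
        by (auto intro!: measurable_compose[OF measurable_Pair1'[of x N borel], of "case_prod A", simplified]
                measurable_compose[OF measurable_Pair1'[of x N borel], of "case_prod B", simplified])
      have int: "integrable unif (A x)" "integrable unif (B x)"
        using AE_unif x by (auto intro!: unif.integrable_const_bound[of _ C] elim: AE_mp)
      have "AE y in unif \<Otimes>\<^sub>M unif. fst y \<in> {0..1}"
        using U2.AE_pair_measure[of "\<lambda>y. fst y \<in> {0..1}"] AE_unif by auto
      then have AE_bnd: "AE y in unif \<Otimes>\<^sub>M unif. norm (if snd y < p x then A x (fst y) else B x (fst y)) \<le> C"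
        by eventually_elim (use x in auto)
      have "integrable (unif \<Otimes>\<^sub>M unif) (\<lambda>y. if snd y < p x then A x (fst y) else B x (fst y))"
        by (rule U2.P.integrable_const_bound[OF AE_bnd]) measurable
      then have "(\<integral>y. F (x, y) \<partial>(unif \<Otimes>\<^sub>M unif)) = (\<integral>s. (\<integral>u. F (x, s, u) \<partial>unif) \<partial>unif)"
        using U2.integral_fst'[of "\<lambda>y. if snd y < p x then A x (fst y) else B x (fst y)"]
        by (simp add: F_def split_beta' cong: if_cong)
      also have "\<dots> = (\<integral>s. p x * A x s + (1 - p x) * B x s \<partial>unif)"
      proof (rule Bochner_Integration.integral_cong[OF refl])
        fix s
        (* this is where \<open>p x \<in> {0..1}\<close> enters: \<open>V\<close> falls below \<open>p x\<close> with probability \<open>p x\<close> *)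
        have "{..<p x} \<inter> {0..1} = {0..<p x}" using x by auto
        then have meas: "measure unif {..<p x} = p x"
          using x by (simp add: unif_def Int_commute)
        have ind: "integrable unif (indicat_real {..<p x})"
          by (rule unif.integrable_const_bound[of _ 1]) auto
        have "(\<integral>u. F (x, s, u) \<partial>unif) = (\<integral>u. B x s + (A x s - B x s) * indicator {..<p x} u \<partial>unif)"
          by (intro Bochner_Integration.integral_cong) (auto simp: F_def)
        also have "\<dots> = B x s + (A x s - B x s) * p x"
          using meas ind unif.prob_space by (subst Bochner_Integration.integral_add) auto
        finally show "(\<integral>u. F (x, s, u) \<partial>unif) = p x * A x s + (1 - p x) * B x s"
          by (simp add: algebra_simps)
      qed
      also have "\<dots> = p x * (\<integral>s. A x s \<partial>unif) + (1 - p x) * (\<integral>s. B x s \<partial>unif)"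
        using int by simp
      finally show ?case by (simp add: x_def)
    qed
  qed measurable
  finally show ?thesis by (simp add: F_def)
qed

lemma integral_uniform:
  fixes f F :: "real \<Rightarrow> real"
  assumes "\<And>x. (F has_real_derivative f x) (at x)" "\<And>x. isCont f x"
  shows "(\<integral>s. f s \<partial>uniform_measure lborel {0..1}) = F 1 - F 0"
proof -
  have [measurable]: "f \<in> borel_measurable borel"
    using assms(2) by (intro borel_measurable_continuous_onI continuous_at_imp_continuous_on) auto
  have "uniform_measure lborel {0..1::real} = density lborel (\<lambda>x. ennreal (indicator {0..1} x))"
    by (simp add: uniform_measure_def ennreal_indicator divide_ennreal_def)
  then have "(\<integral>s. f s \<partial>uniform_measure lborel {0..1}) = (\<integral>x. f x * indicator {0..1} x \<partial>lborel)"
    by (simp add: integral_density mult.commute)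
  also have "\<dots> = F 1 - F 0"
    using assms by (intro integral_FTC_Icc_real) auto
  finally show ?thesis .
qed

lemma integral_uniform_power_left:
  "(\<integral>s. (z * s) ^ k \<partial>uniform_measure lborel {0..1}) = z ^ k / real (Suc k)"
proof -
  have "(\<integral>s. z ^ k * s ^ k \<partial>uniform_measure lborel {0..1}) = z ^ k * 1 ^ Suc k / real (Suc k) - z ^ k * 0 ^ Suc k / real (Suc k)"
    by (intro integral_uniform) (auto intro!: derivative_eq_intros simp: field_simps simp del: of_nat_Suc power_Suc)
  then show ?thesis by (simp add: power_mult_distrib)
qed

text \<open>
  Here \<open>z + (1 - z) s\<close> is uniform on the interval from \<open>z\<close> to \<open>1\<close>, and the average of the \<open>k\<close>-th power
  over it is the geometric sum \<open>(1 - z ^ (k + 1)) / (1 - z)\<close> divided by \<open>k + 1\<close>. Written as a sum, the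
  right-hand side is valid for \<open>z = 1\<close> as well.
\<close>

lemma integral_uniform_power_right:
  "(\<integral>s. (z + (1 - z) * s) ^ k \<partial>uniform_measure lborel {0..1}) = (\<Sum>j\<le>k. z ^ j) / real (Suc k)"
proof (cases "z = 1")
  case True
  have "(\<integral>s. 1 \<partial>uniform_measure lborel {0..1 :: real}) = (\<lambda>s. s) (1::real) - (\<lambda>s. s) (0::real)"
    by (rule integral_uniform) (auto intro: derivative_eq_intros)
  with True show ?thesis by simp
next
  case False
  let ?F = "\<lambda>s. (z + (1 - z) * s) ^ Suc k / (real (Suc k) * (1 - z))"
  have "(\<integral>s. (z + (1 - z) * s) ^ k \<partial>uniform_measure lborel {0..1}) = ?F 1 - ?F 0"
    using False
    by (intro integral_uniform) (auto intro!: derivative_eq_intros simp: divide_simps simp del: of_nat_Suc power_Suc)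
  also have "\<dots> = (1 - z ^ Suc k) / (1 - z) / real (Suc k)"
    using False by (simp add: divide_simps del: of_nat_Suc)
  also have "(1 - z ^ Suc k) / (1 - z) = (\<Sum>j\<le>k. z ^ j)"
    using False sum_gp0[of z k] by simp
  finally show ?thesis .
qed

lemma integral_uniform_square:
  fixes m c :: real
  shows "(\<integral>s. (m + c * (2 * s - 1))\<^sup>2 \<partial>uniform_measure lborel {0..1}) = m\<^sup>2 + c\<^sup>2 / 3"
proof -
  (* an antiderivative of the integrand expanded as \<open>((m - c) + 2 c s)\<^sup>2\<close> *)
  let ?F = "\<lambda>s. (m - c)\<^sup>2 * s + 2 * (m - c) * c * s\<^sup>2 + 4 * c\<^sup>2 * s ^ 3 / 3"
  have "(\<integral>s. (m + c * (2 * s - 1))\<^sup>2 \<partial>uniform_measure lborel {0..1}) = ?F 1 - ?F 0"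
    by (intro integral_uniform)
       (auto intro!: derivative_eq_intros continuous_intros simp: field_simps power2_eq_square power3_eq_cube)
  then show ?thesis by (simp add: field_simps power2_eq_square)
qed

section \<open>Two inequalities for a single state\<close>

text \<open>
  The left-hand side is the conditional expectation of \<open>1 / (L R)\<close> after one step from the state
  \<open>(z, l, r)\<close>. A move to the left, of probability proportional to \<open>l\<close>, multiplies \<open>1 / (l r)\<close> by
  \<open>l / (l + z) \<le> 1 - z / (2 l)\<close>; symmetrically for the right. The weights cancel the denominators \<open>l\<close>
  and \<open>r\<close>, and the two savings \<open>z / 2\<close> and \<open>(1 - z) / 2\<close> add up to \<open>1 / 2\<close> whatever the position \<open>z\<close> is.
\<close>

lemma inverse_product_drift:
  fixes z l r x :: real
  assumes "z \<in> {0..1}" "1 \<le> l" "1 \<le> r" "l + r \<le> x"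
  shows "l / (l + r) / ((l + z) * r) + (1 - l / (l + r)) / (l * (r + (1 - z))) \<le> (1 - 1 / (2 * x)) * (1 / (l * r))"
proof -
  have gain: "a / (a + y) \<le> 1 - y / (2 * a)" if "1 \<le> a" "0 \<le> y" "y \<le> 1" for a y :: real
  proof -
    have "y * y \<le> a * y" using that by (intro mult_right_mono) auto
    then show ?thesis using that by (simp add: field_simps)
  qed
  have "l / (l + r) / ((l + z) * r) + (1 - l / (l + r)) / (l * (r + (1 - z))) =
      (l * (l / (l + z)) + r * (r / (r + (1 - z)))) / ((l + r) * (l * r))"
  proof -
    have "1 - l / (l + r) = r / (l + r)" using assms by (simp add: field_simps)
    then show ?thesis using assms by (simp add: divide_simps)
  qed
  also have "\<dots> \<le> (l * (1 - z / (2 * l)) + r * (1 - (1 - z) / (2 * r))) / ((l + r) * (l * r))"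
    using assms gain[of l z] gain[of r "1 - z"]
    by (intro divide_right_mono add_mono mult_left_mono) auto
  also have "\<dots> = (1 - 1 / (2 * (l + r))) * (1 / (l * r))"
    using assms by (simp add: divide_simps) (simp add: algebra_simps)
  also have "\<dots> \<le> (1 - 1 / (2 * x)) * (1 / (l * r))"
    using assms by (intro mult_right_mono) (auto simp: field_simps)
  finally show ?thesis .
qed

text \<open>
  If \<open>l + r \<le> x\<close>, the first term alone is at least \<open>1 / 2\<close>, by the inequality between the arithmetic and
  the geometric mean. Otherwise the denominator of \<open>\<bar>l - r\<bar> / (2 (l + r))\<close> exceeds \<open>2 x\<close>, and the
  numerator is bounded through the square of the martingale \<open>l - r + 2 z\<close>. The parameter \<open>s\<close> linearises
  the square root that would appear in the Cauchy-Schwarz inequality; it will be \<open>sqrt n\<close>.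
\<close>

lemma imbalance_bound:
  fixes z l r x s :: real
  assumes "z \<in> {0..1}" "1 \<le> l" "1 \<le> r" "1 \<le> x" "0 < s"
  shows "\<bar>l / (l + r) - 1 / 2\<bar> \<le> x\<^sup>2 / 8 * (if l + r \<le> x then 1 / (l * r) else 0) +
    (s / 2 + (l - r + 2 * z)\<^sup>2 / (2 * s) + 2) / (2 * x)"
proof (cases "l + r \<le> x")
  case True
  have "4 * (l * r) \<le> (l + r)\<^sup>2" using sum_squares_bound[of l r] by (simp add: power2_eq_square algebra_simps)
  also have "\<dots> \<le> x\<^sup>2" using True assms by (intro power_mono) auto
  finally have "1 / 2 \<le> x\<^sup>2 / 8 * (1 / (l * r))" using assms by (simp add: field_simps)
  moreover have "0 \<le> l / (l + r)" "l / (l + r) \<le> 1" using assms by simp_all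
  then have "\<bar>l / (l + r) - 1 / 2\<bar> \<le> 1 / 2" by linarith
  moreover have "0 \<le> (s / 2 + (l - r + 2 * z)\<^sup>2 / (2 * s) + 2) / (2 * x)" using assms by simp
  ultimately show ?thesis using True by simp
next
  case False
  define m where "m = l - r + 2 * z"
  have "0 \<le> (s - \<bar>m\<bar>)\<^sup>2" by simp
  then have "2 * s * \<bar>m\<bar> \<le> s\<^sup>2 + m\<^sup>2" by (simp add: power2_diff)
  then have "\<bar>m\<bar> \<le> s / 2 + m\<^sup>2 / (2 * s)" using assms by (simp add: field_simps power2_eq_square)
  moreover have "\<bar>l - r\<bar> \<le> \<bar>m\<bar> + 2" using assms by (auto simp: m_def)
  ultimately have "\<bar>l - r\<bar> \<le> s / 2 + m\<^sup>2 / (2 * s) + 2" by simp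
  then have "\<bar>l - r\<bar> / (2 * (l + r)) \<le> (s / 2 + m\<^sup>2 / (2 * s) + 2) / (2 * x)"
    using False assms by (intro frac_le) auto
  moreover have "l / (l + r) - 1 / 2 = (l - r) / (2 * (l + r))" using assms by (simp add: field_simps)
  ultimately show ?thesis using False assms by (simp add: m_def abs_divide)
qed

section \<open>The walk as a Markov chain driven by independent noise\<close>

text \<open>
  The walk, with its recursion written as a choice between two branches instead of a sum over
  indicators. The noise is allowed to leave \<open>{0..1}\<close> on a null set, so that bounds on the state hold
  only almost surely.
\<close>

locale reinforced_walk = prob_space M for M :: "'a measure" +
  fixes \<xi> U Z L R :: "nat \<Rightarrow> 'a \<Rightarrow> real" and z\<^sub>0 :: real
  assumes z0: "0 \<le> z\<^sub>0" "z\<^sub>0 \<le> 1"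
    and indep: "indep_vars (\<lambda>_. borel) (case_sum \<xi> U) ({1..} <+> {1..})"
    and distr_\<xi>: "distr M borel (\<xi> (Suc n)) = uniform_measure lborel {0..1}"
    and distr_U: "distr M borel (U (Suc n)) = uniform_measure lborel {0..1}"
    and Z_0: "\<omega> \<in> space M \<Longrightarrow> Z 0 \<omega> = z\<^sub>0"
    and L_0: "\<omega> \<in> space M \<Longrightarrow> L 0 \<omega> = 1"
    and R_0: "\<omega> \<in> space M \<Longrightarrow> R 0 \<omega> = 1"
    and Z_Suc: "\<omega> \<in> space M \<Longrightarrow> Z (Suc n) \<omega> =
      (if U (Suc n) \<omega> < L n \<omega> / (L n \<omega> + R n \<omega>) then Z n \<omega> * \<xi> (Suc n) \<omega>
       else Z n \<omega> + (1 - Z n \<omega>) * \<xi> (Suc n) \<omega>)"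
    and L_Suc: "\<omega> \<in> space M \<Longrightarrow> L (Suc n) \<omega> =
      (if U (Suc n) \<omega> < L n \<omega> / (L n \<omega> + R n \<omega>) then L n \<omega> + Z n \<omega> else L n \<omega>)"
    and R_Suc: "\<omega> \<in> space M \<Longrightarrow> R (Suc n) \<omega> =
      (if U (Suc n) \<omega> < L n \<omega> / (L n \<omega> + R n \<omega>) then R n \<omega> else R n \<omega> + (1 - Z n \<omega>))"
begin

definition left_prob :: "nat \<Rightarrow> 'a \<Rightarrow> real" where
  "left_prob n \<omega> = L n \<omega> / (L n \<omega> + R n \<omega>)"

text \<open>
  The noise variables are indexed by a disjoint sum: \<open>Inl i\<close> stands for \<open>\<xi> i\<close> and \<open>Inr i\<close> for \<open>U i\<close>.
\<close>

definition past :: "nat \<Rightarrow> (nat + nat) set" where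
  "past n = {1..n} <+> {1..n}"

lemma measurable_noise [measurable]:
  "\<xi> (Suc n) \<in> borel_measurable M" "U (Suc n) \<in> borel_measurable M"
  using indep by (force simp: indep_vars_def)+

text \<open>
  The state at time \<open>n\<close> is a measurable function of the noise up to time \<open>n\<close>. This gives its
  measurability and its independence of the noise at time \<open>n + 1\<close>.
\<close>

lemma state_factors_through_past:
  "\<exists>f \<in> measurable (PiM (past n) (\<lambda>_. borel)) (borel \<Otimes>\<^sub>M (borel \<Otimes>\<^sub>M borel)).
     \<forall>\<omega>\<in>space M. (Z n \<omega>, L n \<omega>, R n \<omega>) = f (\<lambda>i\<in>past n. case_sum \<xi> U i \<omega>)"
proof (induction n)
  case 0
  show ?case
    by (rule bexI[of _ "\<lambda>_. (z\<^sub>0, 1, 1)"]) (auto simp: Z_0 L_0 R_0)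
next
  case (Suc n)
  then obtain f where
    f [measurable]: "f \<in> measurable (PiM (past n) (\<lambda>_. borel)) (borel \<Otimes>\<^sub>M (borel \<Otimes>\<^sub>M borel))"
    and eq: "\<And>\<omega>. \<omega> \<in> space M \<Longrightarrow> (Z n \<omega>, L n \<omega>, R n \<omega>) = f (\<lambda>i\<in>past n. case_sum \<xi> U i \<omega>)"
    by blast
  define move where "move = (\<lambda>((z::real, l::real, r::real), s::real, u::real).
    if u < l / (l + r) then (z * s, l + z, r) else (z + (1 - z) * s, l, r + (1 - z)))"
  have [measurable]: "move \<in> measurable ((borel \<Otimes>\<^sub>M (borel \<Otimes>\<^sub>M borel)) \<Otimes>\<^sub>M (borel \<Otimes>\<^sub>M borel))
      (borel \<Otimes>\<^sub>M (borel \<Otimes>\<^sub>M borel))"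
    unfolding move_def case_prod_unfold by measurable
  have sub: "past n \<subseteq> past (Suc n)" and new: "Inl (Suc n) \<in> past (Suc n)" "Inr (Suc n) \<in> past (Suc n)"
    by (auto simp: past_def)
  have [measurable]: "(\<lambda>y. y (Inl (Suc n))) \<in> borel_measurable (PiM (past (Suc n)) (\<lambda>_. borel :: real measure))"
    "(\<lambda>y. y (Inr (Suc n))) \<in> borel_measurable (PiM (past (Suc n)) (\<lambda>_. borel :: real measure))"
    using new by (auto intro: measurable_component_singleton)
  have [measurable]: "(\<lambda>y. restrict y (past n)) \<in>
      measurable (PiM (past (Suc n)) (\<lambda>_. borel :: real measure)) (PiM (past n) (\<lambda>_. borel))"
    by (rule measurable_restrict_subset[OF sub])
  let ?g = "\<lambda>y. move (f (restrict y (past n)), y (Inl (Suc n)), y (Inr (Suc n)))"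
  show ?case
  proof (rule bexI[of _ ?g], safe)
    fix \<omega> assume \<omega>: "\<omega> \<in> space M"
    have "restrict (\<lambda>i\<in>past (Suc n). case_sum \<xi> U i \<omega>) (past n) = (\<lambda>i\<in>past n. case_sum \<xi> U i \<omega>)"
      using sub by (auto simp: restrict_def fun_eq_iff)
    then show "(Z (Suc n) \<omega>, L (Suc n) \<omega>, R (Suc n) \<omega>) = ?g (\<lambda>i\<in>past (Suc n). case_sum \<xi> U i \<omega>)"
      using new eq[OF \<omega>, symmetric] \<omega> by (simp add: move_def Z_Suc L_Suc R_Suc)
  qed measurable
qed

lemma measurable_state [measurable]:
  "Z n \<in> borel_measurable M" "L n \<in> borel_measurable M" "R n \<in> borel_measurable M"
proof -
  obtain f where
    f [measurable]: "f \<in> measurable (PiM (past n) (\<lambda>_. borel)) (borel \<Otimes>\<^sub>M (borel \<Otimes>\<^sub>M borel))"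
    and eq: "\<And>\<omega>. \<omega> \<in> space M \<Longrightarrow> (Z n \<omega>, L n \<omega>, R n \<omega>) = f (\<lambda>i\<in>past n. case_sum \<xi> U i \<omega>)"
    using state_factors_through_past[of n] by blast
  have [measurable]: "(\<lambda>\<omega>. \<lambda>i\<in>past n. case_sum \<xi> U i \<omega>) \<in> measurable M (PiM (past n) (\<lambda>_. borel))"
    using indep by (intro measurable_restrict) (auto simp: past_def indep_vars_def)
  have *: "(\<lambda>\<omega>. (Z n \<omega>, L n \<omega>, R n \<omega>)) \<in> measurable M (borel \<Otimes>\<^sub>M (borel \<Otimes>\<^sub>M borel))"
    by (subst measurable_cong[OF eq]) measurable
  show "Z n \<in> borel_measurable M" using measurable_compose[OF * measurable_fst] by simp
  show "L n \<in> borel_measurable M"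
    using measurable_compose[OF measurable_compose[OF * measurable_snd] measurable_fst] by simp
  show "R n \<in> borel_measurable M"
    using measurable_compose[OF measurable_compose[OF * measurable_snd] measurable_snd] by simp
qed

lemma measurable_left_prob [measurable]: "left_prob n \<in> borel_measurable M"
  unfolding left_prob_def by measurable

lemma joint_law_of_state_and_noise:
  "distr M ((borel \<Otimes>\<^sub>M (borel \<Otimes>\<^sub>M borel)) \<Otimes>\<^sub>M (borel \<Otimes>\<^sub>M borel))
      (\<lambda>\<omega>. ((Z n \<omega>, L n \<omega>, R n \<omega>), \<xi> (Suc n) \<omega>, U (Suc n) \<omega>)) =
   distr M (borel \<Otimes>\<^sub>M (borel \<Otimes>\<^sub>M borel)) (\<lambda>\<omega>. (Z n \<omega>, L n \<omega>, R n \<omega>)) \<Otimes>\<^sub>M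
     (uniform_measure lborel {0..1} \<Otimes>\<^sub>M uniform_measure lborel {0..1})"
proof -
  let ?N = "borel \<Otimes>\<^sub>M (borel \<Otimes>\<^sub>M borel) :: (real \<times> real \<times> real) measure"
  let ?B = "borel \<Otimes>\<^sub>M borel :: (real \<times> real) measure"
  let ?W = "\<lambda>A \<omega>. \<lambda>i\<in>A. case_sum \<xi> U i \<omega>" and ?P = "\<lambda>A. PiM A (\<lambda>_::nat + nat. borel :: real measure)"
  obtain f where
    f [measurable]: "f \<in> measurable (PiM (past n) (\<lambda>_. borel)) ?N"
    and eq: "\<And>\<omega>. \<omega> \<in> space M \<Longrightarrow> (Z n \<omega>, L n \<omega>, R n \<omega>) = f (\<lambda>i\<in>past n. case_sum \<xi> U i \<omega>)"
    using state_factors_through_past[of n] by blast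
  define new :: "(nat + nat) set" where "new = {Inl (Suc n), Inr (Suc n)}"
  define g where "g = (\<lambda>y::nat + nat \<Rightarrow> real. (y (Inl (Suc n)), y (Inr (Suc n))))"
  have [measurable]: "g \<in> measurable (?P new) ?B"
    unfolding g_def new_def by (intro measurable_Pair measurable_component_singleton) auto
  have W: "?W A \<in> measurable M (?P A)" if "A \<subseteq> {1..} <+> {1..}" for A
    using that indep by (intro measurable_restrict) (auto simp: indep_vars_def)
  have past_sub: "past n \<subseteq> {1..} <+> {1..}" and new_sub: "new \<subseteq> {1..} <+> {1..}"
    by (auto simp: past_def new_def Plus_def)
  have [measurable]: "?W (past n) \<in> measurable M (?P (past n))" "?W new \<in> measurable M (?P new)"
    using W[OF past_sub] W[OF new_sub] .
  interpret D2: prob_space "distr M (?P new) (?W new)" by (rule prob_space_distr) simp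
  interpret D3: prob_space "distr (distr M (?P new) (?W new)) ?B g" by (rule D2.prob_space_distr) simp
  have noise: "distr M ?B (\<lambda>\<omega>. (\<xi> (Suc n) \<omega>, U (Suc n) \<omega>)) =
      uniform_measure lborel {0..1} \<Otimes>\<^sub>M uniform_measure lborel {0..1}"
  proof -
    let ?l = "{Inl (Suc n)}" and ?r = "{Inr (Suc n)}"
    have "indep_var (?P ?l) (?W ?l) (?P ?r) (?W ?r)"
      by (rule indep_var_restrict[OF indep]) auto
    then have "indep_var borel ((\<lambda>y. y (Inl (Suc n))) \<circ> ?W ?l) borel ((\<lambda>y. y (Inr (Suc n))) \<circ> ?W ?r)"
      by (rule indep_var_compose) (auto intro: measurable_component_singleton)
    then have "indep_var borel (\<xi> (Suc n)) borel (U (Suc n))" by (simp add: comp_def)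
    then show ?thesis unfolding indep_var_distribution_eq distr_\<xi> distr_U by simp
  qed
  have "indep_var (?P (past n)) (?W (past n)) (?P new) (?W new)"
    by (rule indep_var_restrict[OF indep]) (auto simp: past_def new_def)
  then have prod: "distr M (?P (past n)) (?W (past n)) \<Otimes>\<^sub>M distr M (?P new) (?W new) =
      distr M (?P (past n) \<Otimes>\<^sub>M ?P new) (\<lambda>\<omega>. (?W (past n) \<omega>, ?W new \<omega>))"
    unfolding indep_var_distribution_eq by simp
  have "distr M (?N \<Otimes>\<^sub>M ?B) (\<lambda>\<omega>. ((Z n \<omega>, L n \<omega>, R n \<omega>), \<xi> (Suc n) \<omega>, U (Suc n) \<omega>)) =
      distr M (?N \<Otimes>\<^sub>M ?B) (\<lambda>\<omega>. (f (?W (past n) \<omega>), g (?W new \<omega>)))"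
    by (intro distr_cong) (auto simp: eq g_def new_def)
  also have "\<dots> = distr (distr M (?P (past n) \<Otimes>\<^sub>M ?P new) (\<lambda>\<omega>. (?W (past n) \<omega>, ?W new \<omega>)))
      (?N \<Otimes>\<^sub>M ?B) (\<lambda>(x, y). (f x, g y))"
    by (subst distr_distr) (auto simp: comp_def)
  also have "\<dots> = distr (distr M (?P (past n)) (?W (past n))) ?N f \<Otimes>\<^sub>M distr (distr M (?P new) (?W new)) ?B g"
    unfolding prod[symmetric] by (rule pair_measure_distr[symmetric]) (auto intro: D3.sigma_finite_measure_axioms)
  also have "distr (distr M (?P (past n)) (?W (past n))) ?N f = distr M ?N (\<lambda>\<omega>. (Z n \<omega>, L n \<omega>, R n \<omega>))"
    by (subst distr_distr) (auto simp: eq comp_def intro!: distr_cong)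
  also have "distr (distr M (?P new) (?W new)) ?B g = distr M ?B (\<lambda>\<omega>. (\<xi> (Suc n) \<omega>, U (Suc n) \<omega>))"
    by (subst distr_distr, measurable) (rule distr_cong, auto simp: g_def new_def)
  finally show ?thesis unfolding noise .
qed

lemma AE_state_bounds:
  "AE \<omega> in M. \<forall>n. Z n \<omega> \<in> {0..1} \<and> 1 \<le> L n \<omega> \<and> 1 \<le> R n \<omega> \<and> L n \<omega> + R n \<omega> \<le> real n + 2"
proof -
  have "AE \<omega> in M. \<xi> (Suc n) \<omega> \<in> {0..1}" for n
  proof -
    have "AE s in distr M borel (\<xi> (Suc n)). s \<in> {0..1}"
      unfolding distr_\<xi> by (rule AE_uniform_measureI) auto
    then show ?thesis by (subst (asm) AE_distr_iff) auto
  qed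
  then have "AE \<omega> in M. \<forall>n. \<xi> (Suc n) \<omega> \<in> {0..1}" by (simp add: AE_all_countable)
  then show ?thesis using AE_space
  proof eventually_elim
    case (elim \<omega>)
    show ?case
    proof
      fix n
      show "Z n \<omega> \<in> {0..1} \<and> 1 \<le> L n \<omega> \<and> 1 \<le> R n \<omega> \<and> L n \<omega> + R n \<omega> \<le> real n + 2"
      proof (induction n)
        case 0
        then show ?case using elim z0 by (simp add: Z_0 L_0 R_0)
      next
        case (Suc n)
        have s: "0 \<le> \<xi> (Suc n) \<omega>" "\<xi> (Suc n) \<omega> \<le> 1" using elim by auto
        have "0 \<le> (1 - Z n \<omega>) * \<xi> (Suc n) \<omega>" "(1 - Z n \<omega>) * \<xi> (Suc n) \<omega> \<le> 1 - Z n \<omega>"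
          using s Suc by (auto intro!: mult_left_le mult_nonneg_nonneg)
        then show ?case using Suc s elim
          by (auto simp: Z_Suc L_Suc R_Suc intro: mult_le_one)
      qed
    qed
  qed
qed

lemma integrable_of_state_bound:
  fixes f :: "'a \<Rightarrow> real"
  assumes "f \<in> borel_measurable M"
    and "\<And>\<omega>. Z n \<omega> \<in> {0..1} \<Longrightarrow> 1 \<le> L n \<omega> \<Longrightarrow> 1 \<le> R n \<omega> \<Longrightarrow> L n \<omega> + R n \<omega> \<le> real n + 2 \<Longrightarrow> \<bar>f \<omega>\<bar> \<le> C"
  shows "integrable M f"
  using assms(1) AE_state_bounds
  by (intro integrable_const_bound[of _ C]) (auto elim!: AE_mp intro!: assms(2))

lemma expectation_mono_of_state:
  fixes f g :: "'a \<Rightarrow> real"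
  assumes "integrable M f" "integrable M g"
    and "\<And>\<omega>. Z n \<omega> \<in> {0..1} \<Longrightarrow> 1 \<le> L n \<omega> \<Longrightarrow> 1 \<le> R n \<omega> \<Longrightarrow> f \<omega> \<le> g \<omega>"
  shows "expectation f \<le> expectation g"
  using assms(1,2) AE_state_bounds
  by (intro integral_mono_AE) (auto elim!: AE_mp intro!: assms(3))

text \<open>
  The one-step formula from which all drift computations follow: \<open>A\<close> and \<open>B\<close> are the values of the
  observable after a move to the left and to the right, as functions of the present state and of \<open>\<xi>\<close>.
\<close>

lemma expectation_step:
  fixes A B :: "real \<Rightarrow> real \<Rightarrow> real \<Rightarrow> real \<Rightarrow> real"
  defines "unif \<equiv> uniform_measure lborel {0..1 :: real}"
  assumes F: "\<And>\<omega>. \<omega> \<in> space M \<Longrightarrow> F \<omega> =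
      (if U (Suc n) \<omega> < left_prob n \<omega> then A (Z n \<omega>) (L n \<omega>) (R n \<omega>) (\<xi> (Suc n) \<omega>)
       else B (Z n \<omega>) (L n \<omega>) (R n \<omega>) (\<xi> (Suc n) \<omega>))"
    and [measurable]:
      "(\<lambda>((z, l, r), s). A z l r s) \<in> borel_measurable ((borel \<Otimes>\<^sub>M (borel \<Otimes>\<^sub>M borel)) \<Otimes>\<^sub>M borel)"
      "(\<lambda>((z, l, r), s). B z l r s) \<in> borel_measurable ((borel \<Otimes>\<^sub>M (borel \<Otimes>\<^sub>M borel)) \<Otimes>\<^sub>M borel)"
    and bnd: "\<And>z l r s. z \<in> {0..1} \<Longrightarrow> 1 \<le> l \<Longrightarrow> 1 \<le> r \<Longrightarrow> l + r \<le> real n + 2 \<Longrightarrow> s \<in> {0..1} \<Longrightarrow>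
      \<bar>A z l r s\<bar> \<le> C \<and> \<bar>B z l r s\<bar> \<le> C"
  shows "expectation F = expectation (\<lambda>\<omega>.
      left_prob n \<omega> * (\<integral>s. A (Z n \<omega>) (L n \<omega>) (R n \<omega>) s \<partial>unif) +
      (1 - left_prob n \<omega>) * (\<integral>s. B (Z n \<omega>) (L n \<omega>) (R n \<omega>) s \<partial>unif))"
proof -
  let ?N = "borel \<Otimes>\<^sub>M (borel \<Otimes>\<^sub>M borel) :: (real \<times> real \<times> real) measure"
  have "expectation F = expectation (\<lambda>\<omega>. if U (Suc n) \<omega> < left_prob n \<omega>
      then A (Z n \<omega>) (L n \<omega>) (R n \<omega>) (\<xi> (Suc n) \<omega>) else B (Z n \<omega>) (L n \<omega>) (R n \<omega>) (\<xi> (Suc n) \<omega>))"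
    by (intro Bochner_Integration.integral_cong F refl)
  also have "\<dots> = expectation (\<lambda>\<omega>.
      left_prob n \<omega> * (\<integral>s. A (Z n \<omega>) (L n \<omega>) (R n \<omega>) s \<partial>unif) +
      (1 - left_prob n \<omega>) * (\<integral>s. B (Z n \<omega>) (L n \<omega>) (R n \<omega>) s \<partial>unif))"
  proof -
    let ?X = "\<lambda>\<omega>. (Z n \<omega>, L n \<omega>, R n \<omega>)" and ?p = "\<lambda>(z, l, r). l / (l + r)"
    let ?A = "\<lambda>(z, l, r). A z l r" and ?B = "\<lambda>(z, l, r). B z l r"
    have "expectation (\<lambda>\<omega>. if U (Suc n) \<omega> < ?p (?X \<omega>)
        then ?A (?X \<omega>) (\<xi> (Suc n) \<omega>) else ?B (?X \<omega>) (\<xi> (Suc n) \<omega>)) =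
      expectation (\<lambda>\<omega>. ?p (?X \<omega>) * (\<integral>s. ?A (?X \<omega>) s \<partial>unif) + (1 - ?p (?X \<omega>)) * (\<integral>s. ?B (?X \<omega>) s \<partial>unif))"
      unfolding unif_def
    proof (rule expectation_uniform_branch[OF _ _ _ joint_law_of_state_and_noise distr_\<xi>])
      show "AE \<omega> in M. ?p (?X \<omega>) \<in> {0..1} \<and>
         (\<forall>s\<in>{0..1}. \<bar>?A (?X \<omega>) s\<bar> \<le> C \<and> \<bar>?B (?X \<omega>) s\<bar> \<le> C)"
        using AE_state_bounds
      proof eventually_elim
        case (elim \<omega>)
        then have b: "Z n \<omega> \<in> {0..1}" "1 \<le> L n \<omega>" "1 \<le> R n \<omega>" "L n \<omega> + R n \<omega> \<le> real n + 2" by auto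
        moreover from b have "0 \<le> L n \<omega> / (L n \<omega> + R n \<omega>)" "L n \<omega> / (L n \<omega> + R n \<omega>) \<le> 1" by simp_all
        ultimately show ?case using bnd by auto
      qed
      show "case_prod ?A \<in> borel_measurable (?N \<Otimes>\<^sub>M borel)" "case_prod ?B \<in> borel_measurable (?N \<Otimes>\<^sub>M borel)"
        using assms(3,4) by (simp_all add: case_prod_unfold)
      show "?p \<in> borel_measurable ?N" by measurable
    qed measurable
    then show ?thesis by (simp add: left_prob_def cong: if_cong)
  qed
  finally show ?thesis .
qed

subsection \<open>The left probability tends to one half\<close>

text \<open>
  The squares of the orthogonal increments \<open>Z (2 \<xi> - 1)\<close> or \<open>(1 - Z) (2 \<xi> - 1)\<close> add up, and each has
  conditional mean at most \<open>1 / 3\<close>, the second moment of \<open>2 \<xi> - 1\<close>. The position-dependent correction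
  \<open>2 Z\<close> turns \<open>L - R\<close> into a martingale: both the drift of \<open>L - R\<close> and that of \<open>- 2 Z\<close> equal \<open>Z\<close> minus the
  probability of a move to the right.
\<close>

lemma second_moment_balance:
  "expectation (\<lambda>\<omega>. (L n \<omega> - R n \<omega> + 2 * Z n \<omega>)\<^sup>2) \<le> 4 + real n / 3"
proof (induction n)
  case 0
  have "expectation (\<lambda>\<omega>. (L 0 \<omega> - R 0 \<omega> + 2 * Z 0 \<omega>)\<^sup>2) = expectation (\<lambda>\<omega>. (2 * z\<^sub>0)\<^sup>2)"
    by (rule Bochner_Integration.integral_cong) (auto simp: Z_0 L_0 R_0)
  also have "\<dots> \<le> 2\<^sup>2" using z0 by (simp add: prob_space power_le_one)
  finally show ?case by simp
next
  case (Suc n)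
  let ?m = "\<lambda>z l r. l - r + 2 * z :: real"
  (* \<open>\<bar>l - r\<bar> \<le> n\<close>, \<open>2 z \<le> 2\<close> and an increment of at most 1; the constant is not sharp *)
  have bnd: "\<bar>(?m z l r + c * (2 * s - 1))\<^sup>2\<bar> \<le> (real n + 5)\<^sup>2"
    if "z \<in> {0..1}" "1 \<le> l" "1 \<le> r" "l + r \<le> real n + 2" "s \<in> {0..1}" "c \<in> {0..1}" for z l r s c
  proof -
    have "\<bar>c * (2 * s - 1)\<bar> \<le> 1" using that by (auto simp: abs_mult intro!: mult_le_one)
    then have "\<bar>?m z l r + c * (2 * s - 1)\<bar> \<le> \<bar>real n + 5\<bar>" using that by auto
    then show ?thesis unfolding abs_power2 by (subst power2_le_iff_abs_le) auto
  qed
  have int: "integrable M (\<lambda>\<omega>. (?m (Z n \<omega>) (L n \<omega>) (R n \<omega>))\<^sup>2)"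
    by (rule integrable_of_state_bound[where n = n and C = "(real n + 5)\<^sup>2"])
       (use bnd[of _ _ _ 0 0] in auto)
  have avg: "left_prob n \<omega> * (m + (Z n \<omega>)\<^sup>2 / 3) + (1 - left_prob n \<omega>) * (m + (1 - Z n \<omega>)\<^sup>2 / 3) \<le> m + 1 / 3"
    if "Z n \<omega> \<in> {0..1}" "1 \<le> L n \<omega>" "1 \<le> R n \<omega>" for \<omega> m
  proof (rule convex_bound_le)
    show "0 \<le> left_prob n \<omega>" "0 \<le> 1 - left_prob n \<omega>" using that by (simp_all add: left_prob_def)
  qed (use that in \<open>auto intro!: power_le_one\<close>)
  have "expectation (\<lambda>\<omega>. (L (Suc n) \<omega> - R (Suc n) \<omega> + 2 * Z (Suc n) \<omega>)\<^sup>2) =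
    expectation (\<lambda>\<omega>. left_prob n \<omega> * (\<integral>s. (?m (Z n \<omega>) (L n \<omega>) (R n \<omega>) + Z n \<omega> * (2 * s - 1))\<^sup>2 \<partial>uniform_measure lborel {0..1}) +
      (1 - left_prob n \<omega>) * (\<integral>s. (?m (Z n \<omega>) (L n \<omega>) (R n \<omega>) + (1 - Z n \<omega>) * (2 * s - 1))\<^sup>2 \<partial>uniform_measure lborel {0..1}))"
  proof (rule expectation_step[where A = "\<lambda>z l r s. (?m z l r + z * (2 * s - 1))\<^sup>2"
          and B = "\<lambda>z l r s. (?m z l r + (1 - z) * (2 * s - 1))\<^sup>2" and C = "(real n + 5)\<^sup>2"])
    show "\<bar>(?m z l r + z * (2 * s - 1))\<^sup>2\<bar> \<le> (real n + 5)\<^sup>2 \<and> \<bar>(?m z l r + (1 - z) * (2 * s - 1))\<^sup>2\<bar> \<le> (real n + 5)\<^sup>2"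
      if "z \<in> {0..1}" "1 \<le> l" "1 \<le> r" "l + r \<le> real n + 2" "s \<in> {0..1}" for z l r s
      using that bnd[of z l r s z] bnd[of z l r s "1 - z"] by simp
  qed (auto simp: Z_Suc L_Suc R_Suc left_prob_def algebra_simps case_prod_unfold)
  also have "\<dots> \<le> expectation (\<lambda>\<omega>. (?m (Z n \<omega>) (L n \<omega>) (R n \<omega>))\<^sup>2 + 1 / 3)"
    unfolding integral_uniform_square
  proof (rule expectation_mono_of_state[where n = n])
    fix \<omega> assume "Z n \<omega> \<in> {0..1}" "1 \<le> L n \<omega>" "1 \<le> R n \<omega>"
    then show "left_prob n \<omega> * ((?m (Z n \<omega>) (L n \<omega>) (R n \<omega>))\<^sup>2 + (Z n \<omega>)\<^sup>2 / 3) +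
        (1 - left_prob n \<omega>) * ((?m (Z n \<omega>) (L n \<omega>) (R n \<omega>))\<^sup>2 + (1 - Z n \<omega>)\<^sup>2 / 3)
      \<le> (?m (Z n \<omega>) (L n \<omega>) (R n \<omega>))\<^sup>2 + 1 / 3"
      by (rule avg)
  next
    show "integrable M (\<lambda>\<omega>. left_prob n \<omega> * ((?m (Z n \<omega>) (L n \<omega>) (R n \<omega>))\<^sup>2 + (Z n \<omega>)\<^sup>2 / 3) +
        (1 - left_prob n \<omega>) * ((?m (Z n \<omega>) (L n \<omega>) (R n \<omega>))\<^sup>2 + (1 - Z n \<omega>)\<^sup>2 / 3))"
    proof (rule integrable_of_state_bound[where n = n and C = "(real n + 5)\<^sup>2 + 1 / 3"])
      fix \<omega> assume st: "Z n \<omega> \<in> {0..1}" "1 \<le> L n \<omega>" "1 \<le> R n \<omega>" and T: "L n \<omega> + R n \<omega> \<le> real n + 2"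
      have m: "(?m (Z n \<omega>) (L n \<omega>) (R n \<omega>))\<^sup>2 \<le> (real n + 5)\<^sup>2"
        using bnd[of "Z n \<omega>" "L n \<omega>" "R n \<omega>" 0 0] st T by simp
      have "0 \<le> left_prob n \<omega> * ((?m (Z n \<omega>) (L n \<omega>) (R n \<omega>))\<^sup>2 + (Z n \<omega>)\<^sup>2 / 3) +
        (1 - left_prob n \<omega>) * ((?m (Z n \<omega>) (L n \<omega>) (R n \<omega>))\<^sup>2 + (1 - Z n \<omega>)\<^sup>2 / 3)"
        using st by (intro add_nonneg_nonneg mult_nonneg_nonneg) (simp_all add: left_prob_def)
      then show "\<bar>left_prob n \<omega> * ((?m (Z n \<omega>) (L n \<omega>) (R n \<omega>))\<^sup>2 + (Z n \<omega>)\<^sup>2 / 3) +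
        (1 - left_prob n \<omega>) * ((?m (Z n \<omega>) (L n \<omega>) (R n \<omega>))\<^sup>2 + (1 - Z n \<omega>)\<^sup>2 / 3)\<bar> \<le> (real n + 5)\<^sup>2 + 1 / 3"
        using avg[OF st, of "(?m (Z n \<omega>) (L n \<omega>) (R n \<omega>))\<^sup>2"] m by linarith
    qed measurable
  qed (use int in simp_all)
  also have "\<dots> \<le> 4 + real (Suc n) / 3"
    using Suc int by (simp add: prob_space field_simps)
  finally show ?case .
qed

text \<open>
  The event \<open>L + R \<le> x\<close> shrinks as time passes, since \<open>L + R\<close> increases. One may therefore test it
  before the step instead of after it, at the price of an inequality, and it then is part of the
  present state, where \<open>inverse_product_drift\<close> applies.
\<close>

lemma expected_inverse_product_le:
  assumes "1 \<le> x"
  shows "expectation (\<lambda>\<omega>. if L n \<omega> + R n \<omega> \<le> x then 1 / (L n \<omega> * R n \<omega>) else 0) \<le> (1 - 1 / (2 * x)) ^ n"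
proof (induction n)
  case 0
  have "expectation (\<lambda>\<omega>. if L 0 \<omega> + R 0 \<omega> \<le> x then 1 / (L 0 \<omega> * R 0 \<omega>) else 0) =
      expectation (\<lambda>\<omega>. if 2 \<le> x then 1 else 0)"
    by (rule Bochner_Integration.integral_cong) (auto simp: L_0 R_0)
  also have "\<dots> \<le> 1" by (simp add: prob_space)
  finally show ?case by simp
next
  case (Suc n)
  let ?f = "\<lambda>l r. if l + r \<le> x then 1 / (l * r) else (0 :: real)"
  let ?g = "\<lambda>n \<omega>. if L n \<omega> + R n \<omega> \<le> x then 1 / (L (Suc n) \<omega> * R (Suc n) \<omega>) else 0"
  let ?u = "uniform_measure lborel {0..1 :: real}"
  have unit: "\<bar>1 / (l * r)\<bar> \<le> 1" if "1 \<le> l" "1 \<le> r" for l r :: real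
    using that mult_mono[of 1 l 1 r] by simp
  have unif_one: "prob_space ?u" by (rule prob_space_uniform_measure) auto
  have int_f: "integrable M (\<lambda>\<omega>. ?f (L n \<omega>) (R n \<omega>))" for n
    by (rule integrable_of_state_bound[where n = n and C = 1]) (use unit in auto)
  have bnds: "\<bar>if l + r \<le> x then 1 / ((l + z) * r) else 0\<bar> \<le> 1"
      "\<bar>if l + r \<le> x then 1 / (l * (r + (1 - z))) else 0\<bar> \<le> 1"
    if "z \<in> {0..1}" "1 \<le> l" "1 \<le> r" for l r z
    using that unit[of "l + z" r] unit[of l "r + (1 - z)"] by auto
  have "expectation (\<lambda>\<omega>. ?f (L (Suc n) \<omega>) (R (Suc n) \<omega>)) \<le> expectation (?g n)"
  proof (rule integral_mono_AE)
    show "AE \<omega> in M. ?f (L (Suc n) \<omega>) (R (Suc n) \<omega>) \<le> ?g n \<omega>"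
      using AE_state_bounds AE_space
    proof eventually_elim
      case (elim \<omega>)
      show ?case
        using spec[OF elim(1), of n] elim(2) by (auto simp: L_Suc R_Suc)
    qed
    show "integrable M (?g n)"
      by (rule integrable_of_state_bound[where n = "Suc n" and C = 1]) (use unit in auto)
  qed (rule int_f)
  also have "expectation (?g n) = expectation (\<lambda>\<omega>.
      left_prob n \<omega> * (\<integral>s. (if L n \<omega> + R n \<omega> \<le> x then 1 / ((L n \<omega> + Z n \<omega>) * R n \<omega>) else 0) \<partial>?u) +
      (1 - left_prob n \<omega>) * (\<integral>s. (if L n \<omega> + R n \<omega> \<le> x then 1 / (L n \<omega> * (R n \<omega> + (1 - Z n \<omega>))) else 0) \<partial>?u))"
  proof (rule expectation_step[where A = "\<lambda>z l r s. if l + r \<le> x then 1 / ((l + z) * r) else 0"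
        and B = "\<lambda>z l r s. if l + r \<le> x then 1 / (l * (r + (1 - z))) else 0" and C = 1])
    show "?g n \<omega> = (if U (Suc n) \<omega> < left_prob n \<omega>
        then if L n \<omega> + R n \<omega> \<le> x then 1 / ((L n \<omega> + Z n \<omega>) * R n \<omega>) else 0
        else if L n \<omega> + R n \<omega> \<le> x then 1 / (L n \<omega> * (R n \<omega> + (1 - Z n \<omega>))) else 0)"
      if "\<omega> \<in> space M" for \<omega>
      using that by (simp add: L_Suc R_Suc left_prob_def)
  qed (use bnds in \<open>simp_all add: case_prod_unfold\<close>)
  also have "\<dots> = expectation (\<lambda>\<omega>. if L n \<omega> + R n \<omega> \<le> x
      then left_prob n \<omega> / ((L n \<omega> + Z n \<omega>) * R n \<omega>) + (1 - left_prob n \<omega>) / (L n \<omega> * (R n \<omega> + (1 - Z n \<omega>)))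
      else 0)"
    using prob_space.prob_space[OF unif_one] by (intro Bochner_Integration.integral_cong) auto
  also have "\<dots> \<le> expectation (\<lambda>\<omega>. (1 - 1 / (2 * x)) * ?f (L n \<omega>) (R n \<omega>))"
  proof (rule expectation_mono_of_state[where n = n])
    have pt: "left_prob n \<omega> / ((L n \<omega> + Z n \<omega>) * R n \<omega>) + (1 - left_prob n \<omega>) / (L n \<omega> * (R n \<omega> + (1 - Z n \<omega>)))
        \<le> (1 - 1 / (2 * x)) * (1 / (L n \<omega> * R n \<omega>))"
      if "Z n \<omega> \<in> {0..1}" "1 \<le> L n \<omega>" "1 \<le> R n \<omega>" "L n \<omega> + R n \<omega> \<le> x" for \<omega>
      using that inverse_product_drift[of "Z n \<omega>" "L n \<omega>" "R n \<omega>" x] by (simp add: left_prob_def)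
    then show "(if L n \<omega> + R n \<omega> \<le> x
      then left_prob n \<omega> / ((L n \<omega> + Z n \<omega>) * R n \<omega>) + (1 - left_prob n \<omega>) / (L n \<omega> * (R n \<omega> + (1 - Z n \<omega>)))
      else 0) \<le> (1 - 1 / (2 * x)) * ?f (L n \<omega>) (R n \<omega>)"
      if "Z n \<omega> \<in> {0..1}" "1 \<le> L n \<omega>" "1 \<le> R n \<omega>" for \<omega>
      using that by auto
    show "integrable M (\<lambda>\<omega>. if L n \<omega> + R n \<omega> \<le> x
      then left_prob n \<omega> / ((L n \<omega> + Z n \<omega>) * R n \<omega>) + (1 - left_prob n \<omega>) / (L n \<omega> * (R n \<omega> + (1 - Z n \<omega>)))
      else 0)"
    proof (rule integrable_of_state_bound[where n = n and C = 1])
      fix \<omega> assume st: "Z n \<omega> \<in> {0..1}" "1 \<le> L n \<omega>" "1 \<le> R n \<omega>"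
      have "(1 - 1 / (2 * x)) * (1 / (L n \<omega> * R n \<omega>)) \<le> 1 * 1"
        using unit[OF st(2,3)] st assms by (intro mult_mono) auto
      moreover have "0 \<le> left_prob n \<omega> / ((L n \<omega> + Z n \<omega>) * R n \<omega>) + (1 - left_prob n \<omega>) / (L n \<omega> * (R n \<omega> + (1 - Z n \<omega>)))"
        using st by (intro add_nonneg_nonneg divide_nonneg_nonneg) (auto simp: left_prob_def)
      ultimately show "\<bar>if L n \<omega> + R n \<omega> \<le> x
          then left_prob n \<omega> / ((L n \<omega> + Z n \<omega>) * R n \<omega>) + (1 - left_prob n \<omega>) / (L n \<omega> * (R n \<omega> + (1 - Z n \<omega>)))
          else 0\<bar> \<le> 1"
        using pt[OF st] by auto
    qed measurable
  qed (use int_f in simp)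
  also have "\<dots> \<le> (1 - 1 / (2 * x)) * (1 - 1 / (2 * x)) ^ n"
    using Suc assms by (simp add: mult_left_mono)
  finally show ?case by simp
qed

text \<open>
  Any level \<open>x\<close> works that is large compared with \<open>sqrt n\<close> and small compared with \<open>n / ln n\<close>: the
  first makes the fluctuation \<open>\<bar>L - R\<bar>\<close> negligible against \<open>x\<close>, the second makes \<open>L + R \<le> x\<close> unlikely.
\<close>

lemma left_prob_tendsto_half:
  "(\<lambda>n. expectation (\<lambda>\<omega>. \<bar>left_prob n \<omega> - 1 / 2\<bar>)) \<longlonglongrightarrow> 0"
proof -
  define x where "x = (\<lambda>n. real n powr (3 / 4))"
  define bound where "bound = (\<lambda>n. (x n)\<^sup>2 / 8 * exp (- real n / (2 * x n)) +
     (sqrt (real n) / 2 + (4 + real n / 3) / (2 * sqrt (real n)) + 2) / (2 * x n))"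
  have lim: "bound \<longlonglongrightarrow> 0"
    unfolding bound_def x_def by real_asymp
  have le: "\<forall>\<^sub>F n in sequentially. expectation (\<lambda>\<omega>. \<bar>left_prob n \<omega> - 1 / 2\<bar>) \<le> bound n"
    using eventually_ge_at_top[of 1]
  proof eventually_elim
    case (elim n)
    have x: "1 \<le> x n" using elim by (simp add: x_def ge_one_powr_ge_zero)
    define s where "s = sqrt (real n)"
    have s: "0 < s" using elim by (simp add: s_def)
    let ?f = "\<lambda>\<omega>. if L n \<omega> + R n \<omega> \<le> x n then 1 / (L n \<omega> * R n \<omega>) else 0"
    let ?m = "\<lambda>\<omega>. (L n \<omega> - R n \<omega> + 2 * Z n \<omega>)\<^sup>2"
    have int_f: "integrable M ?f"
    proof (rule integrable_of_state_bound[where n = n and C = 1])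
      fix \<omega> assume "1 \<le> L n \<omega>" "1 \<le> R n \<omega>"
      then show "\<bar>?f \<omega>\<bar> \<le> 1" using mult_mono[of 1 "L n \<omega>" 1 "R n \<omega>"] by simp
    qed measurable
    have int_m: "integrable M ?m"
    proof (rule integrable_of_state_bound[where n = n and C = "(real n + 4)\<^sup>2"])
      fix \<omega> assume "Z n \<omega> \<in> {0..1}" "1 \<le> L n \<omega>" "1 \<le> R n \<omega>" "L n \<omega> + R n \<omega> \<le> real n + 2"
      then show "\<bar>?m \<omega>\<bar> \<le> (real n + 4)\<^sup>2"
        unfolding abs_power2 by (subst power2_le_iff_abs_le) auto
    qed measurable
    have "expectation (\<lambda>\<omega>. \<bar>left_prob n \<omega> - 1 / 2\<bar>) \<le>
        expectation (\<lambda>\<omega>. (x n)\<^sup>2 / 8 * ?f \<omega> + (s / 2 + ?m \<omega> / (2 * s) + 2) / (2 * x n))"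
    proof (rule expectation_mono_of_state[where n = n])
      show "integrable M (\<lambda>\<omega>. \<bar>left_prob n \<omega> - 1 / 2\<bar>)"
        by (rule integrable_of_state_bound[where n = n and C = 1]) (auto simp: left_prob_def abs_le_iff divide_simps)
      show "\<bar>left_prob n \<omega> - 1 / 2\<bar> \<le> (x n)\<^sup>2 / 8 * ?f \<omega> + (s / 2 + ?m \<omega> / (2 * s) + 2) / (2 * x n)"
        if "Z n \<omega> \<in> {0..1}" "1 \<le> L n \<omega>" "1 \<le> R n \<omega>" for \<omega>
        using imbalance_bound[OF that x s] unfolding left_prob_def .
    qed (use int_f int_m in simp)
    also have "\<dots> = (x n)\<^sup>2 / 8 * expectation ?f + (s / 2 + expectation ?m / (2 * s) + 2) / (2 * x n)"
      using int_f int_m by (simp add: prob_space)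
    also have "\<dots> \<le> bound n"
      unfolding bound_def s_def[symmetric]
    proof (intro add_mono mult_left_mono divide_right_mono order_refl second_moment_balance)
      have "expectation ?f \<le> (1 - 1 / (2 * x n)) ^ n"
        by (rule expected_inverse_product_le[OF x])
      also have "\<dots> \<le> exp (- (1 / (2 * x n))) ^ n"
        using x exp_ge_add_one_self[of "- (1 / (2 * x n))"] by (intro power_mono) auto
      also have "\<dots> = exp (- real n / (2 * x n))" by (simp flip: exp_of_nat_mult)
      finally show "expectation ?f \<le> exp (- real n / (2 * x n))" .
    qed (use x s in auto)
    finally show ?case .
  qed
  show ?thesis
    by (rule tendsto_sandwich[OF _ le tendsto_const lim]) simp
qed

subsection \<open>Convergence of the moments and of the law\<close>

text \<open>
  A move to the left contributes \<open>Z ^ k / (k + 1)\<close>, a move to the right \<open>(1 + Z + ... + Z ^ k) / (k + 1)\<close>.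
  The coefficients of the top power \<open>Z ^ k\<close> add up to \<open>1\<close>, so that the random left probability
  multiplies only lower powers.
\<close>

lemma moment_step:
  "expectation (\<lambda>\<omega>. Z (Suc n) \<omega> ^ k) =
     (expectation (\<lambda>\<omega>. Z n \<omega> ^ k) + expectation (\<lambda>\<omega>. (1 - left_prob n \<omega>) * (\<Sum>j<k. Z n \<omega> ^ j))) / real (Suc k)"
proof -
  let ?u = "uniform_measure lborel {0..1 :: real}"
  have int: "integrable M (\<lambda>\<omega>. Z n \<omega> ^ k)"
    by (rule integrable_of_state_bound[where n = n and C = 1]) (auto intro!: power_le_one)
  have int': "integrable M (\<lambda>\<omega>. (1 - left_prob n \<omega>) * (\<Sum>j<k. Z n \<omega> ^ j))"
  proof (rule integrable_of_state_bound[where n = n and C = "real k"])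
    fix \<omega> assume st: "Z n \<omega> \<in> {0..1}" "1 \<le> L n \<omega>" "1 \<le> R n \<omega>"
    have "\<bar>(1 - left_prob n \<omega>) * (\<Sum>j<k. Z n \<omega> ^ j)\<bar> \<le> 1 * (\<Sum>j<k. 1)"
      unfolding abs_mult
    proof (rule mult_mono)
      show "\<bar>1 - left_prob n \<omega>\<bar> \<le> 1" using st by (simp add: left_prob_def)
      show "\<bar>\<Sum>j<k. Z n \<omega> ^ j\<bar> \<le> (\<Sum>j<k. 1)"
        using st by (intro order_trans[OF sum_abs] sum_mono) (auto intro!: power_le_one)
    qed auto
    then show "\<bar>(1 - left_prob n \<omega>) * (\<Sum>j<k. Z n \<omega> ^ j)\<bar> \<le> real k" by simp
  qed measurable
  have mix: "p * (a / c) + (1 - p) * ((t + a) / c) = (a + (1 - p) * t) / c" for p a c t :: real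
    by (simp add: diff_divide_distrib add_divide_distrib algebra_simps)
  have "expectation (\<lambda>\<omega>. Z (Suc n) \<omega> ^ k) = expectation (\<lambda>\<omega>.
      left_prob n \<omega> * (\<integral>s. (Z n \<omega> * s) ^ k \<partial>?u) + (1 - left_prob n \<omega>) * (\<integral>s. (Z n \<omega> + (1 - Z n \<omega>) * s) ^ k \<partial>?u))"
  proof (rule expectation_step[where A = "\<lambda>z l r s. (z * s) ^ k" and B = "\<lambda>z l r s. (z + (1 - z) * s) ^ k" and C = 1])
    fix z l r s :: real assume "z \<in> {0..1}" "s \<in> {0..1}"
    moreover from this have "(1 - z) * s \<le> 1 - z" "0 \<le> (1 - z) * s" by (auto intro: mult_left_le)
    ultimately show "\<bar>(z * s) ^ k\<bar> \<le> 1 \<and> \<bar>(z + (1 - z) * s) ^ k\<bar> \<le> 1"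
      by (auto simp: power_abs[symmetric] abs_mult intro!: power_le_one mult_le_one)
  qed (auto simp: Z_Suc left_prob_def case_prod_unfold)
  also have "\<dots> = expectation (\<lambda>\<omega>. (Z n \<omega> ^ k + (1 - left_prob n \<omega>) * (\<Sum>j<k. Z n \<omega> ^ j)) / real (Suc k))"
    unfolding integral_uniform_power_left integral_uniform_power_right
    by (simp only: lessThan_Suc_atMost[symmetric] sum.lessThan_Suc mix)
  also have "\<dots> = (expectation (\<lambda>\<omega>. Z n \<omega> ^ k) + expectation (\<lambda>\<omega>. (1 - left_prob n \<omega>) * (\<Sum>j<k. Z n \<omega> ^ j))) / real (Suc k)"
    using int int' by simp
  finally show ?thesis .
qed

text \<open>
  With the right probability replaced by \<open>1 / 2\<close>, \<open>moment_step\<close> is a linear recursion for the \<open>k\<close>-th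
  moment with contraction factor \<open>1 / (k + 1)\<close> and an inhomogeneity that converges by the induction
  hypothesis; the equation for its fixed point is the identity assumed of \<open>\<mu>\<close>.
\<close>

lemma moments_tendsto:
  assumes \<mu>: "\<And>k. (\<Sum>j<k. \<mu> j) = 2 * real k * \<mu> k" and "\<mu> 0 = 1"
  shows "(\<lambda>n. expectation (\<lambda>\<omega>. Z n \<omega> ^ k)) \<longlonglongrightarrow> \<mu> k"
proof (induction k rule: less_induct)
  case (less k)
  show ?case
  proof (cases "k = 0")
    case True
    then show ?thesis using assms(2) by (simp add: prob_space)
  next
    case False
    define S where "S = (\<lambda>n \<omega>. \<Sum>j<k. Z n \<omega> ^ j)"
    have int_pow: "integrable M (\<lambda>\<omega>. Z n \<omega> ^ j)" for n j
      by (rule integrable_of_state_bound[where n = n and C = 1]) (auto intro!: power_le_one)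
    have int_S: "integrable M (S n)" for n unfolding S_def by (intro Bochner_Integration.integrable_sum int_pow)
    have [measurable]: "S n \<in> borel_measurable M" for n unfolding S_def by measurable
    have S_bnd: "\<bar>S n \<omega>\<bar> \<le> real k" if "Z n \<omega> \<in> {0..1}" for n \<omega>
    proof -
      have "\<bar>S n \<omega>\<bar> \<le> (\<Sum>j<k. 1)"
        unfolding S_def using that by (intro order_trans[OF sum_abs] sum_mono) (auto intro!: power_le_one)
      then show ?thesis by simp
    qed
    have pt: "\<bar>(1 / 2 - left_prob n \<omega>) * S n \<omega>\<bar> \<le> real k * \<bar>left_prob n \<omega> - 1 / 2\<bar>" if "Z n \<omega> \<in> {0..1}" for n \<omega>
      using S_bnd[OF that] by (simp add: abs_mult abs_minus_commute mult.commute[of "real k"] mult_left_mono)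
    have lp: "\<bar>left_prob n \<omega> - 1 / 2\<bar> \<le> 1" if "1 \<le> L n \<omega>" "1 \<le> R n \<omega>" for n \<omega>
    proof -
      have "0 \<le> left_prob n \<omega>" "left_prob n \<omega> \<le> 1" using that by (simp_all add: left_prob_def)
      then show ?thesis by linarith
    qed
    have int_lp: "integrable M (\<lambda>\<omega>. \<bar>left_prob n \<omega> - 1 / 2\<bar>)" for n
      by (rule integrable_of_state_bound[where n = n and C = 1]) (use lp in auto)
    have int_err: "integrable M (\<lambda>\<omega>. (1 / 2 - left_prob n \<omega>) * S n \<omega>)" for n
    proof (rule integrable_of_state_bound[where n = n and C = "real k * 1"])
      fix \<omega> assume "Z n \<omega> \<in> {0..1}" "1 \<le> L n \<omega>" "1 \<le> R n \<omega>"
      then show "\<bar>(1 / 2 - left_prob n \<omega>) * S n \<omega>\<bar> \<le> real k * 1"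
        using pt lp by (intro order_trans[OF pt] mult_left_mono) auto
    qed measurable
    have err: "(\<lambda>n. expectation (\<lambda>\<omega>. (1 / 2 - left_prob n \<omega>) * S n \<omega>)) \<longlonglongrightarrow> 0"
    proof (rule Lim_null_comparison)
      show "(\<lambda>n. real k * expectation (\<lambda>\<omega>. \<bar>left_prob n \<omega> - 1 / 2\<bar>)) \<longlonglongrightarrow> 0"
        using tendsto_mult_left[OF left_prob_tendsto_half, of "real k"] by simp
      have "norm (expectation (\<lambda>\<omega>. (1 / 2 - left_prob n \<omega>) * S n \<omega>)) \<le>
          real k * expectation (\<lambda>\<omega>. \<bar>left_prob n \<omega> - 1 / 2\<bar>)" for n
      proof -
        have "norm (expectation (\<lambda>\<omega>. (1 / 2 - left_prob n \<omega>) * S n \<omega>)) \<le> expectation (\<lambda>\<omega>. \<bar>(1 / 2 - left_prob n \<omega>) * S n \<omega>\<bar>)"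
          unfolding real_norm_def by (rule integral_abs_bound)
        also have "\<dots> \<le> expectation (\<lambda>\<omega>. real k * \<bar>left_prob n \<omega> - 1 / 2\<bar>)"
          using int_err int_lp pt by (intro expectation_mono_of_state[where n = n]) auto
        finally show ?thesis by simp
      qed
      then show "\<forall>\<^sub>F n in sequentially. norm (expectation (\<lambda>\<omega>. (1 / 2 - left_prob n \<omega>) * S n \<omega>)) \<le>
          real k * expectation (\<lambda>\<omega>. \<bar>left_prob n \<omega> - 1 / 2\<bar>)" by simp
    qed
    define b where "b = (\<lambda>n. (1 / 2 * (\<Sum>j<k. expectation (\<lambda>\<omega>. Z n \<omega> ^ j)) +
        expectation (\<lambda>\<omega>. (1 / 2 - left_prob n \<omega>) * S n \<omega>)) / real (Suc k))"
    have "b \<longlonglongrightarrow> (1 / 2 * (\<Sum>j<k. \<mu> j) + 0) / real (Suc k)"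
      unfolding b_def using less err by (intro tendsto_intros) auto
    then have b: "b \<longlonglongrightarrow> real k * \<mu> k / real (Suc k)" by (simp add: \<mu>)
    have "expectation (\<lambda>\<omega>. Z (Suc n) \<omega> ^ k) = 1 / real (Suc k) * expectation (\<lambda>\<omega>. Z n \<omega> ^ k) + b n" for n
    proof -
      have "expectation (\<lambda>\<omega>. (1 - left_prob n \<omega>) * S n \<omega>) =
          expectation (\<lambda>\<omega>. 1 / 2 * S n \<omega> + (1 / 2 - left_prob n \<omega>) * S n \<omega>)"
        by (intro Bochner_Integration.integral_cong) (auto simp: algebra_simps)
      also have "\<dots> = 1 / 2 * expectation (S n) + expectation (\<lambda>\<omega>. (1 / 2 - left_prob n \<omega>) * S n \<omega>)"
        using int_S int_err by simp
      also have "expectation (S n) = (\<Sum>j<k. expectation (\<lambda>\<omega>. Z n \<omega> ^ j))"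
        unfolding S_def by (intro Bochner_Integration.integral_sum int_pow)
      finally have split: "expectation (\<lambda>\<omega>. (1 - left_prob n \<omega>) * S n \<omega>) =
          1 / 2 * (\<Sum>j<k. expectation (\<lambda>\<omega>. Z n \<omega> ^ j)) + expectation (\<lambda>\<omega>. (1 / 2 - left_prob n \<omega>) * S n \<omega>)" .
      have "expectation (\<lambda>\<omega>. Z (Suc n) \<omega> ^ k) =
          (expectation (\<lambda>\<omega>. Z n \<omega> ^ k) + expectation (\<lambda>\<omega>. (1 - left_prob n \<omega>) * S n \<omega>)) / real (Suc k)"
        unfolding S_def by (rule moment_step)
      then show ?thesis
        unfolding split b_def by (simp add: add_divide_distrib del: of_nat_Suc)
    qed
    from linear_recursion_tendsto[OF this _ _ b]
    have "(\<lambda>n. expectation (\<lambda>\<omega>. Z n \<omega> ^ k)) \<longlonglongrightarrow> real k * \<mu> k / real (Suc k) / (1 - 1 / real (Suc k))"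
      using False by simp
    also have "1 - 1 / real (Suc k) = real k / real (Suc k)" by (simp add: field_simps)
    also have "real k * \<mu> k / real (Suc k) / (real k / real (Suc k)) = \<mu> k" using False by simp
    finally show ?thesis .
  qed
qed

lemma weak_conv_arcsine:
  "weak_conv_m (\<lambda>n. distr M borel (Z n)) (beta_distribution (1 / 2) (1 / 2))"
proof (rule weak_conv_if_moments_converge)
  show "real_distribution (distr M borel (Z n))" for n by simp
  show "real_distribution (beta_distribution (1 / 2) (1 / 2))" by (rule real_distribution_beta) auto
  show "AE x in distr M borel (Z n). x \<in> {0..1}" for n
    using AE_state_bounds by (subst AE_distr_iff) (auto elim!: AE_mp)
  show "AE x in beta_distribution (1 / 2) (1 / 2). x \<in> {0..1}" by (rule AE_beta_distribution)
  show "(\<lambda>n. \<integral>x. x ^ k \<partial>distr M borel (Z n)) \<longlonglongrightarrow> (\<integral>x. x ^ k \<partial>beta_distribution (1 / 2) (1 / 2))" for k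
    using moments_tendsto[of "\<lambda>k. Beta (1 / 2 + real k) (1 / 2) / Beta (1 / 2) (1 / 2)" k] sum_arcsine_moments
      Beta_real_pos[of "1 / 2" "1 / 2"]
    by (simp add: integral_distr beta_moment)
qed

end

section \<open>The arcsine limit law\<close>

theorem theorem4p4:
  fixes M :: "'a measure"
    and \<xi> U Z L R :: "nat \<Rightarrow> 'a \<Rightarrow> real"
    and z\<^sub>0 :: real
  assumes "prob_space M"
    and "0 < z\<^sub>0" and "z\<^sub>0 < 1"
    and "prob_space.indep_vars M (\<lambda>_. borel) (case_sum \<xi> U) ({1..} <+> {1..})"
    and "\<And>n. n \<ge> 1 \<Longrightarrow> distr M borel (\<xi> n) = uniform_measure lborel {0..1}"
    and "\<And>n. n \<ge> 1 \<Longrightarrow> distr M borel (U n) = uniform_measure lborel {0..1}"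
    and "\<And>\<omega>. \<omega> \<in> space M \<Longrightarrow> Z 0 \<omega> = z\<^sub>0"
    and "\<And>\<omega>. \<omega> \<in> space M \<Longrightarrow> L 0 \<omega> = 1"
    and "\<And>\<omega>. \<omega> \<in> space M \<Longrightarrow> R 0 \<omega> = 1"
    and "\<And>n \<omega>. n \<ge> 1 \<Longrightarrow> \<omega> \<in> space M \<Longrightarrow>
           Z n \<omega> =
             Z (n - 1) \<omega> * \<xi> n \<omega> *
               of_bool (U n \<omega> < L (n - 1) \<omega> / (L (n - 1) \<omega> + R (n - 1) \<omega>)) +
             (Z (n - 1) \<omega> + (1 - Z (n - 1) \<omega>) * \<xi> n \<omega>) *
               of_bool (U n \<omega> \<ge> L (n - 1) \<omega> / (L (n - 1) \<omega> + R (n - 1) \<omega>))"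
    and "\<And>n \<omega>. n \<ge> 1 \<Longrightarrow> \<omega> \<in> space M \<Longrightarrow>
           L n \<omega> = L (n - 1) \<omega> +
             Z (n - 1) \<omega> *
               of_bool (U n \<omega> < L (n - 1) \<omega> / (L (n - 1) \<omega> + R (n - 1) \<omega>))"
    and "\<And>n \<omega>. n \<ge> 1 \<Longrightarrow> \<omega> \<in> space M \<Longrightarrow>
           R n \<omega> = R (n - 1) \<omega> +
             (1 - Z (n - 1) \<omega>) *
               of_bool (U n \<omega> \<ge> L (n - 1) \<omega> / (L (n - 1) \<omega> + R (n - 1) \<omega>))"
  shows "weak_conv_m (\<lambda>n. distr M borel (Z n)) (beta_distribution (1/2) (1/2))"
proof -
  have "reinforced_walk M \<xi> U Z L R z\<^sub>0"
  proof (intro reinforced_walk.intro reinforced_walk_axioms.intro)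
    fix n \<omega> assume \<omega>: "\<omega> \<in> space M"
    show "Z (Suc n) \<omega> = (if U (Suc n) \<omega> < L n \<omega> / (L n \<omega> + R n \<omega>) then Z n \<omega> * \<xi> (Suc n) \<omega>
        else Z n \<omega> + (1 - Z n \<omega>) * \<xi> (Suc n) \<omega>)"
      using assms(10)[of "Suc n", OF _ \<omega>] by (simp add: not_less)
    show "L (Suc n) \<omega> = (if U (Suc n) \<omega> < L n \<omega> / (L n \<omega> + R n \<omega>) then L n \<omega> + Z n \<omega> else L n \<omega>)"
      using assms(11)[of "Suc n", OF _ \<omega>] by simp
    show "R (Suc n) \<omega> = (if U (Suc n) \<omega> < L n \<omega> / (L n \<omega> + R n \<omega>) then R n \<omega> else R n \<omega> + (1 - Z n \<omega>))"
      using assms(12)[of "Suc n", OF _ \<omega>] by (simp add: not_less)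
  qed (use assms in simp_all)
  then show ?thesis by (rule reinforced_walk.weak_conv_arcsine)
qed

end
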